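(* Let $k \in \mathbb{N}_{>0}$, $B \in \mathbb{N}_{>1}$, and let $e \colon \mathbb{P} \to \mathbb{N}_{>0}$ be a map with $B^{e(p)-k} \leq p < B^{e(p)}$ for any $p \in \mathbb{P}$ with $p > B$. Define $R \colon \mathbb{P} \to \mathbb{N}$ by $R(p) := B^{e(p)}$. For any $f \colon \mathbb{P} \to \mathbb{N}$, if $f(p) + p\mathbb{Z}$ represents $\mathrm{REDC}_{p,R(p)}$ regarded as an $\mathbb{F}_p$-linear homomorphism for all but finitely many $p \in \mathbb{P}$ with $p > B$, then the image of $f$ in $\mathcal{A}$ is naively transcendental.
   Context: $\mathbb{N}$ is the set of non-negative integers, $\mathbb{P}$ is the set of prime numbers, and $\mathbb{F}_p = \mathbb{Z}/p\mathbb{Z}$. Set $\mathcal{A} := \prod_{p \in \mathbb{P}} \mathbb{F}_p \big/ \bigoplus_{p \in \mathbb{P}} \mathbb{F}_p$, which is a $\mathbb{Q}$-algebra (every nonzero integer is invertible modulo all but finitely many primes). For a map $a \colon \mathbb{P} \to \mathbb{N}$, the image of $a$ in $\mathcal{A}$ is the class of $(a(p) + p\mathbb{Z})_{p \in \mathbb{P}}$. An element $\alpha \in \mathcal{A}$ is naively transcendental if there is no $F \in \mathbb{Q}[x] \setminus \{0\}$ with $F(\alpha) = 0$ in $\mathcal{A}$. For $N, R \in \mathbb{N}_{>0}$ with $N < R$ and $\gcd(N,R) = 1$, the Montgomery reduction $\mathrm{REDC}_{N,R}$ is the map $\mathbb{Z}/N\mathbb{Z} \to \mathbb{Z}/N\mathbb{Z}$,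 $i + N\mathbb{Z} \mapsto iR' + N\mathbb{Z}$, where $R' \in \mathbb{N}$, $R' < N$, is the modular inverse of $R$ modulo $N$. The element of $\mathbb{Z}/N\mathbb{Z}$ representing $\mathrm{REDC}_{N,R}$ regarded as a $\mathbb{Z}/N\mathbb{Z}$-linear homomorphism is $\mathrm{REDC}_{N,R}(1 + N\mathbb{Z}) = R' + N\mathbb{Z}$. For a prime $p > B$, $\mathrm{REDC}_{p,R(p)}$ makes sense because $p < R(p)$ and $\gcd(p, R(p)) = 1$. *)

theory Defs
  imports
    "HOL-Number_Theory.Number_Theory"
    "HOL-Algebra.QuotRing"
    "HOL-Computational_Algebra.Polynomial"
begin

section \<open>Products and direct sums of rings\<close>

definition product_ring :: "'i set \<Rightarrow> ('i \<Rightarrow> 'a ring) \<Rightarrow> ('i \<Rightarrow> 'a) ring" where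
  "product_ring I R =
     \<lparr>carrier = (\<Pi>\<^sub>E i\<in>I. carrier (R i)),
      monoid.mult = (\<lambda>x y. \<lambda>i\<in>I. x i \<otimes>\<^bsub>R i\<^esub> y i),
      one = (\<lambda>i\<in>I. \<one>\<^bsub>R i\<^esub>),
      zero = (\<lambda>i\<in>I. \<zero>\<^bsub>R i\<^esub>),
      add = (\<lambda>x y. \<lambda>i\<in>I. x i \<oplus>\<^bsub>R i\<^esub> y i)\<rparr>"

definition direct_sum_ideal :: "'i set \<Rightarrow> ('i \<Rightarrow> 'a ring) \<Rightarrow> ('i \<Rightarrow> 'a) set" where
  "direct_sum_ideal I R =
     {x \<in> carrier (product_ring I R). finite {i \<in> I. x i \<noteq> \<zero>\<^bsub>R i\<^esub>}}"

lemma cring_product_ring: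
  assumes "\<And>i. i \<in> I \<Longrightarrow> cring (R i)"
  shows "cring (product_ring I R)"
proof (rule cringI)
  note cr = assms[THEN cring.axioms(1)]
  note ab = cr[THEN ring.is_abelian_group]
  note am = ab[THEN abelian_group.axioms(1)]
  note mo = cr[THEN ring.is_monoid]
  show "abelian_group (product_ring I R)"
  proof (rule abelian_groupI)
    fix x assume x: "x \<in> carrier (product_ring I R)"
    show "\<exists>y\<in>carrier (product_ring I R). y \<oplus>\<^bsub>product_ring I R\<^esub> x = \<zero>\<^bsub>product_ring I R\<^esub>"
      by (rule bexI[of _ "\<lambda>i\<in>I. \<ominus>\<^bsub>R i\<^esub> x i"])
        (use x in \<open>auto simp: product_ring_def PiE_iff abelian_group.l_neg[OF ab]
            abelian_group.a_inv_closed[OF ab] intro!: restrict_ext\<close>)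
  qed (auto simp: product_ring_def PiE_iff extensional_def restrict_def fun_eq_iff
         abelian_monoid.a_closed[OF am] abelian_monoid.zero_closed[OF am]
         abelian_monoid.a_assoc[OF am] abelian_monoid.a_comm[OF am]
         abelian_monoid.l_zero[OF am]
         ring.ring_simprules(7,10,15,22)[OF cr])
  show "comm_monoid (product_ring I R)"
    by (rule comm_monoidI)
      (auto simp: product_ring_def PiE_iff extensional_def restrict_def fun_eq_iff
         monoid.m_closed[OF mo] monoid.one_closed[OF mo] monoid.m_assoc[OF mo]
         monoid.l_one[OF mo] comm_monoid.m_comm[OF assms[THEN cring.axioms(2)]]
         monoid.r_one[OF mo] comm_monoid.m_lcomm[OF assms[THEN cring.axioms(2)]])
  show "(x \<oplus>\<^bsub>product_ring I R\<^esub> y) \<otimes>\<^bsub>product_ring I R\<^esub> z =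
      x \<otimes>\<^bsub>product_ring I R\<^esub> z \<oplus>\<^bsub>product_ring I R\<^esub> y \<otimes>\<^bsub>product_ring I R\<^esub> z"
    if "x \<in> carrier (product_ring I R)" "y \<in> carrier (product_ring I R)"
       "z \<in> carrier (product_ring I R)" for x y z
    using that by (auto simp: product_ring_def PiE_iff ring.ring_simprules(13)[OF cr] intro!: restrict_ext)
qed

lemma ideal_direct_sum_ideal:
  assumes "\<And>i. i \<in> I \<Longrightarrow> cring (R i)"
  shows "ideal (direct_sum_ideal I R) (product_ring I R)"
proof -
  let ?P = "product_ring I R" and ?D = "direct_sum_ideal I R"
  interpret P: cring ?P by (rule cring_product_ring) (rule assms)
  note cr = assms[THEN cring.axioms(1)]
  have mult: "x \<otimes>\<^bsub>?P\<^esub> a \<in> ?D" if a: "a \<in> ?D" and x: "x \<in> carrier ?P" for a x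
  proof -
    have "{i \<in> I. (x \<otimes>\<^bsub>?P\<^esub> a) i \<noteq> \<zero>\<^bsub>R i\<^esub>} \<subseteq> {i \<in> I. a i \<noteq> \<zero>\<^bsub>R i\<^esub>}"
      using x by (auto simp: product_ring_def PiE_iff ring.ring_simprules(25)[OF cr])
    then show ?thesis
      using a x P.m_closed[OF x, of a] by (auto simp: direct_sum_ideal_def intro: finite_subset)
  qed
  have add: "a \<oplus>\<^bsub>?P\<^esub> b \<in> ?D" if a: "a \<in> ?D" and b: "b \<in> ?D" for a b
  proof -
    have "{i \<in> I. (a \<oplus>\<^bsub>?P\<^esub> b) i \<noteq> \<zero>\<^bsub>R i\<^esub>} \<subseteq> {i \<in> I. a i \<noteq> \<zero>\<^bsub>R i\<^esub>} \<union> {i \<in> I. b i \<noteq> \<zero>\<^bsub>R i\<^esub>}"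
      by (auto simp: product_ring_def ring.ring_simprules(8)[OF cr] ring.ring_simprules(2)[OF cr])
    moreover have "finite ({i \<in> I. a i \<noteq> \<zero>\<^bsub>R i\<^esub>} \<union> {i \<in> I. b i \<noteq> \<zero>\<^bsub>R i\<^esub>})"
      using a b by (simp add: direct_sum_ideal_def)
    ultimately have "finite {i \<in> I. (a \<oplus>\<^bsub>?P\<^esub> b) i \<noteq> \<zero>\<^bsub>R i\<^esub>}" by (rule finite_subset)
    then show ?thesis
      using a b P.a_closed by (simp add: direct_sum_ideal_def)
  qed
  have zero: "\<zero>\<^bsub>?P\<^esub> \<in> ?D"
  proof -
    have "{i \<in> I. \<zero>\<^bsub>?P\<^esub> i \<noteq> \<zero>\<^bsub>R i\<^esub>} = {}"
      by (auto simp: product_ring_def)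
    then show ?thesis
      using P.zero_closed unfolding direct_sum_ideal_def by (simp only: mem_Collect_eq finite.emptyI)
  qed
  have carr: "?D \<subseteq> carrier ?P"
    by (auto simp: direct_sum_ideal_def)
  show ?thesis
  proof (rule idealI[OF P.ring_axioms])
    show "subgroup ?D (add_monoid ?P)"
    proof (rule group.subgroupI[OF P.a_group])
      fix a assume a: "a \<in> ?D"
      then have "\<ominus>\<^bsub>?P\<^esub> a = (\<ominus>\<^bsub>?P\<^esub> \<one>\<^bsub>?P\<^esub>) \<otimes>\<^bsub>?P\<^esub> a"
        using carr by (simp add: P.l_minus subset_iff)
      then have "\<ominus>\<^bsub>?P\<^esub> a \<in> ?D"
        using mult[OF a] by simp
      then show "inv\<^bsub>add_monoid ?P\<^esub> a \<in> ?D"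
        by (simp add: a_inv_def)
    qed (use add zero carr in auto)
  qed (use mult carr P.m_comm in \<open>auto simp: subset_iff\<close>)
qed

section \<open>Integers modulo almost all primes\<close>

abbreviation primes :: "nat set" where
  "primes \<equiv> {p. prime p}"

abbreviation (input) prime_field :: "nat \<Rightarrow> int ring" where
  "prime_field p \<equiv> residue_ring (int p)"

definition ring_A :: "(nat \<Rightarrow> int) set ring" where
  "ring_A = product_ring primes prime_field Quot direct_sum_ideal primes prime_field"

definition image_A :: "(nat \<Rightarrow> nat) \<Rightarrow> (nat \<Rightarrow> int) set" where
  "image_A a =
     direct_sum_ideal primes prime_field +>\<^bsub>product_ring primes prime_field\<^esub>
       (\<lambda>p\<in>primes. int (a p) mod int p)"

lemma cring_prime_field: "p \<in> primes \<Longrightarrow> cring (prime_field p)"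
  using residues.cring[of "int p"] prime_gt_1_nat[of p] by (simp add: residues_def)

lemma cring_ring_A: "cring ring_A"
  unfolding ring_A_def
  by (intro ideal.quotient_is_cring ideal_direct_sum_ideal cring_product_ring cring_prime_field)

lemma rat_denominator_in_Units_ring_A:
  fixes n :: int
  assumes n: "n > 0"
  shows "[n] \<cdot>\<^bsub>ring_A\<^esub> \<one>\<^bsub>ring_A\<^esub> \<in> Units ring_A"
proof -
  let ?P = "product_ring primes prime_field" and ?I = "direct_sum_ideal primes prime_field"
  define h where "h = (+>\<^bsub>?P\<^esub>) ?I"
  interpret P: cring ?P by (intro cring_product_ring cring_prime_field)
  interpret I: ideal ?I ?P by (intro ideal_direct_sum_ideal cring_prime_field)
  interpret A: cring ring_A by (rule cring_ring_A)
  interpret h: ring_hom_ring ?P ring_A h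
    using I.rcos_ring_hom_ring by (simp add: ring_A_def h_def)
  define m where "m = nat n"
  have m: "m > 0" "n = int m"
    using n by (simp_all add: m_def)
  define x where "x j = (\<lambda>p\<in>primes. int j mod int p)" for j
  define y where "y = (\<lambda>p\<in>primes. modular_inverse (int p) n)"
  have carr: "x j \<in> carrier ?P" for j
    by (auto simp: x_def product_ring_def residue_ring_def prime_gt_0_nat)
  have y: "y \<in> carrier ?P"
    by (auto simp: y_def product_ring_def residue_ring_def prime_gt_0_nat
        modular_inverse_int_nonneg modular_inverse_int_less)
  have x1: "x 1 = \<one>\<^bsub>?P\<^esub>"
    using prime_gt_1_nat by (auto simp: x_def product_ring_def residue_ring_def intro!: restrict_ext)
  have x0: "x 0 = \<zero>\<^bsub>?P\<^esub>"
    by (auto simp: x_def product_ring_def residue_ring_def intro!: restrict_ext)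
  have xS: "x (Suc j) = x j \<oplus>\<^bsub>?P\<^esub> x 1" for j
    by (auto simp: x_def product_ring_def residue_ring_def mod_simps add.commute intro!: restrict_ext)
  have hx: "h (x 0) = \<zero>\<^bsub>ring_A\<^esub>" "h (x (Suc j)) = h (x j) \<oplus>\<^bsub>ring_A\<^esub> \<one>\<^bsub>ring_A\<^esub>" for j
    using carr[of j] by (simp_all only: x0 xS x1 h.hom_zero h.hom_add h.hom_one P.one_closed)
  have pow: "[j] \<cdot>\<^bsub>ring_A\<^esub> \<one>\<^bsub>ring_A\<^esub> = h (x j)" for j :: nat
    by (induction j) (simp_all add: hx A.add.nat_pow_Suc)
  have diff: "x m \<otimes>\<^bsub>?P\<^esub> y \<ominus>\<^bsub>?P\<^esub> \<one>\<^bsub>?P\<^esub> \<in> ?I"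
  proof -
    define z where "z = x m \<otimes>\<^bsub>?P\<^esub> y \<ominus>\<^bsub>?P\<^esub> \<one>\<^bsub>?P\<^esub>"
    have z: "z \<in> carrier ?P"
      using carr y by (simp add: z_def)
    have "z \<oplus>\<^bsub>?P\<^esub> \<one>\<^bsub>?P\<^esub> = x m \<otimes>\<^bsub>?P\<^esub> y"
      using carr[of m] y by (simp add: z_def P.minus_eq P.a_assoc P.l_neg)
    have "z p = 0" if p: "prime p" "\<not> p \<le> m" for p
    proof -
      have "coprime n (int p)"
        using p m by (metis coprime_commute coprime_int_iff nat_dvd_not_less not_le prime_imp_coprime)
      then have "int m * modular_inverse (int p) n mod int p = 1"
        using cong_modular_inverse1[of n "int p"] m prime_gt_1_nat[OF p(1)] by (simp add: cong_def)
      moreover have "(z p + 1) mod int p = int m * modular_inverse (int p) n mod int p"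
        using fun_cong[OF \<open>z \<oplus>\<^bsub>?P\<^esub> \<one>\<^bsub>?P\<^esub> = x m \<otimes>\<^bsub>?P\<^esub> y\<close>, of p] p
        by (simp add: product_ring_def residue_ring_def x_def y_def mod_simps)
      ultimately have "int p dvd z p"
        using prime_gt_1_nat[OF p(1)]
        by (metis add_diff_cancel_right' mod_eq_dvd_iff of_nat_1 of_nat_less_iff mod_pos_pos_trivial zero_le_one)
      moreover have "0 \<le> z p" "z p < int p"
        using z p by (auto simp: product_ring_def residue_ring_def PiE_iff)
      ultimately show "z p = 0"
        by (metis mod_pos_pos_trivial dvd_imp_mod_0)
    qed
    then have "{p \<in> primes. z p \<noteq> \<zero>\<^bsub>prime_field p\<^esub>} \<subseteq> {..m}"
      by (auto simp: residue_ring_def)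
    then have "finite {p \<in> primes. z p \<noteq> \<zero>\<^bsub>prime_field p\<^esub>}"
      by (rule finite_subset) simp
    with z have "z \<in> ?I"
      unfolding direct_sum_ideal_def by blast
    then show ?thesis
      by (simp only: z_def)
  qed
  have "h (x m \<otimes>\<^bsub>?P\<^esub> y \<ominus>\<^bsub>?P\<^esub> \<one>\<^bsub>?P\<^esub>) = \<zero>\<^bsub>ring_A\<^esub>"
    using I.a_rcos_const[OF diff] by (simp add: h_def ring_A_def FactRing_def)
  then have "h (x m) \<otimes>\<^bsub>ring_A\<^esub> h y \<ominus>\<^bsub>ring_A\<^esub> \<one>\<^bsub>ring_A\<^esub> = \<zero>\<^bsub>ring_A\<^esub>"
    using carr[of m] y
    by (simp only: P.minus_eq A.minus_eq h.hom_add h.hom_mult h.hom_one h.hom_a_inv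
        P.m_closed P.one_closed P.a_inv_closed)
  then have "h (x m) \<otimes>\<^bsub>ring_A\<^esub> h y = \<one>\<^bsub>ring_A\<^esub>"
    by (rule A.r_right_minus_eq[THEN iffD1, rotated 2])
      (intro A.m_closed A.one_closed h.hom_closed carr y)+
  then have "h (x m) \<in> Units ring_A"
    using h.hom_closed[OF carr[of m]] h.hom_closed[OF y] A.m_comm[of "h (x m)" "h y"]
    unfolding Units_def by auto
  then show ?thesis
    using pow[of m] n by (simp add: add_pow_int_ge m_def)
qed

section \<open>Naive transcendence\<close>

text \<open>
  In a ring where the image of every nonzero integer is invertible, such as \<^const>\<open>ring_A\<close>,
  \<open>rat_image R\<close> is the structure map of \<open>R\<close> as an algebra over the rationals.
\<close>
definition rat_image :: "('a, 'b) ring_scheme \<Rightarrow> rat \<Rightarrow> 'a" where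
  "rat_image R q =
     ([fst (quotient_of q)] \<cdot>\<^bsub>R\<^esub> \<one>\<^bsub>R\<^esub>) \<otimes>\<^bsub>R\<^esub> inv\<^bsub>R\<^esub> ([snd (quotient_of q)] \<cdot>\<^bsub>R\<^esub> \<one>\<^bsub>R\<^esub>)"

definition rat_poly_eval :: "('a, 'b) ring_scheme \<Rightarrow> rat poly \<Rightarrow> 'a \<Rightarrow> 'a" where
  "rat_poly_eval R F \<alpha> = (\<Oplus>\<^bsub>R\<^esub>i\<in>{..degree F}. rat_image R (coeff F i) \<otimes>\<^bsub>R\<^esub> (\<alpha> [^]\<^bsub>R\<^esub> i))"

definition naively_transcendental :: "(nat \<Rightarrow> int) set \<Rightarrow> bool" where
  "naively_transcendental \<alpha> \<longleftrightarrow>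
     \<alpha> \<in> carrier ring_A \<and> \<not> (\<exists>F :: rat poly. F \<noteq> 0 \<and> rat_poly_eval ring_A F \<alpha> = \<zero>\<^bsub>ring_A\<^esub>)"

section \<open>Montgomery reduction\<close>

text \<open>
  Residue classes modulo \<open>N\<close> are given by their representatives in \<open>{0..N - 1}\<close>.
  The definition is meaningful for \<open>0 < N < R\<close> with \<open>N\<close> and \<open>R\<close> coprime;
  then \<open>modular_inverse (int N) (int R)\<close> is the inverse of \<open>R\<close> in that range.
\<close>
definition REDC :: "nat \<Rightarrow> nat \<Rightarrow> int \<Rightarrow> int" where
  "REDC N R x = x \<otimes>\<^bsub>residue_ring (int N)\<^esub> modular_inverse (int N) (int R)"

text \<open>
  A linear endomorphism of \<open>\<int>/N\<int>\<close> is multiplication by a unique element, which represents it.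
\<close>
definition represents_endo :: "nat \<Rightarrow> int \<Rightarrow> (int \<Rightarrow> int) \<Rightarrow> bool" where
  "represents_endo N c \<phi> \<longleftrightarrow>
     c \<in> carrier (residue_ring (int N)) \<and>
     (\<forall>x \<in> carrier (residue_ring (int N)). \<phi> x = c \<otimes>\<^bsub>residue_ring (int N)\<^esub> x)"

lemma represents_endo_REDC_iff:
  assumes "N > 1"
  shows "represents_endo N c (REDC N R) \<longleftrightarrow> c = REDC N R \<one>\<^bsub>residue_ring (int N)\<^esub>"
proof -
  interpret residues "int N" "residue_ring (int N)"
    using assms by unfold_locales auto
  have m: "modular_inverse (int N) (int R) \<in> {0..int N - 1}"
    using assms modular_inverse_int_less[of "int N" "int R"]
    by (auto simp: modular_inverse_int_nonneg)
  then show ?thesis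
    using assms by (auto simp: represents_endo_def REDC_def residue_ring_def mult.commute
      dest!: bspec[where x = 1])
qed

end

(*
  If F(f) = 0 with F of degree d, then modulo almost all primes p the residue f(p) is inverse to
  B^e(p), so p divides G(B^e(p)) for the reversed integer polynomial G(y) = y^d F(1/y). Distinct
  primes with e(p) = m all divide the single number G(B^m), which is nonzero for large m and of
  size O(B^(md)), while each of them is at least B^(m-k); hence their number is bounded by a
  constant independent of m. As 1/p <= B^k / B^e(p), a geometric series then bounds the sum of
  the reciprocals of the primes, which diverges.
*)
theory Submission
  imports Defs "HOL-Computational_Algebra.Squarefree"
begin

section \<open>Divergence of the sum of the prime reciprocals\<close>

text \<open>In a squarefree number all multiplicities are 1, so the set of its prime factors
  determines it.\<close>

lemma prod_prime_factors_squarefree_part: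
  fixes n :: nat
  shows "\<Prod>(prime_factors (squarefree_part n)) = squarefree_part n"
proof -
  have "squarefree_part n = (\<Prod>p\<in>prime_factors (squarefree_part n). p ^ multiplicity p (squarefree_part n))"
    using prod_prime_factors[of "squarefree_part n"] by simp
  also have "\<dots> = \<Prod>(prime_factors (squarefree_part n))"
  proof (rule prod.cong)
    fix p assume p: "p \<in> prime_factors (squarefree_part n)"
    then have "multiplicity p (squarefree_part n) \<ge> 1"
      by (auto simp: prime_factors_multiplicity)
    moreover have "multiplicity p (squarefree_part n) \<le> 1"
      using p prime_multiplicity_squarefree_part_le_Suc_0[of p n] by auto
    ultimately show "p ^ multiplicity p (squarefree_part n) = p" by simp
  qed simp
  finally show ?thesis by simp
qed

text \<open>A number is determined by its squarefree part and its square part. The former is encoded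
  by a subset of \<open>S\<close>, which gives at most \<open>2 ^ card S\<close> choices. The square
  of the latter divides \<open>n \<le> y^2\<close>, so there are at most \<open>y\<close>
  choices.\<close>

lemma card_smooth_le:
  fixes S :: "nat set"
  assumes "finite S"
  shows "card {n\<in>{1..y\<^sup>2}. prime_factors n \<subseteq> S} \<le> 2 ^ card S * y"
proof -
  let ?A = "{n\<in>{1..y\<^sup>2}. prime_factors n \<subseteq> S}"
  define g where "g n = (prime_factors (squarefree_part n), square_part n)" for n :: nat
  have "inj_on g ?A"
  proof (rule inj_onI)
    fix m n assume "g m = g n"
    then have "prime_factors (squarefree_part m) = prime_factors (squarefree_part n)"
      and "square_part m = square_part n"
      by (simp_all only: g_def prod.inject)
    then show "m = n"
      by (metis prod_prime_factors_squarefree_part squarefree_decomposition_unique)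
  qed
  moreover have "g ` ?A \<subseteq> Pow S \<times> {1..y}"
  proof
    fix z assume "z \<in> g ` ?A"
    then obtain n where n: "n \<in> ?A" "z = g n" by auto
    have dec: "n = squarefree_part n * square_part n ^ 2"
      by (rule squarefree_decompose)
    have factors: "prime_factors (squarefree_part n) \<subseteq> prime_factors n"
      using n dec by (intro dvd_prime_factors) (auto intro: dvdI)
    have "square_part n ^ 2 \<le> n"
      using n by (intro dvd_imp_le) auto
    moreover have "n \<le> y\<^sup>2" using n by simp
    ultimately have "square_part n ^ 2 \<le> y\<^sup>2" by (rule order.trans)
    then have "square_part n \<le> y"
      by (simp only: power2_nat_le_eq_le)
    moreover have "square_part n \<noteq> 0" using n by simp
    then have "square_part n \<ge> 1" by linarith
    ultimately show "z \<in> Pow S \<times> {1..y}"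
      using n factors by (auto simp: g_def)
  qed
  ultimately have "card ?A \<le> card (Pow S \<times> {1..y})"
    using assms by (intro card_inj_on_le) auto
  also have "\<dots> = 2 ^ card S * y"
    using assms by (simp add: card_cartesian_product card_Pow)
  finally show ?thesis .
qed

lemma card_multiples_le: "card {n\<in>{1..x}. p dvd n} \<le> x div p" for p x :: nat
proof (cases "p = 0")
  case False
  have "{n\<in>{1..x}. p dvd n} \<subseteq> (*) p ` {1..x div p}"
  proof
    fix n assume "n \<in> {n\<in>{1..x}. p dvd n}"
    then obtain j where "n = p * j" "1 \<le> n" "n \<le> x" by auto
    moreover from this have "j \<le> x div p"
      using False by (metis div_le_mono nonzero_mult_div_cancel_left)
    ultimately show "n \<in> (*) p ` {1..x div p}"
      by (intro image_eqI[of _ _ j]) (auto simp: Suc_le_eq)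
  qed
  then have "card {n\<in>{1..x}. p dvd n} \<le> card ((*) p ` {1..x div p})"
    by (intro card_mono) auto
  also have "\<dots> \<le> x div p"
    using card_image_le[of "{1..x div p}" "(*) p"] by simp
  finally show ?thesis .
qed auto

text \<open>
  The argument of Erdos: if the reciprocals of the primes from \<open>M\<close> on sum to less than a half, then more than
  half of the numbers up to \<open>y\<^sup>2\<close> have only prime factors below \<open>M\<close>, but there are only \<open>O(y)\<close> of these.
\<close>
theorem not_summable_prime_reciprocals:
  "\<not> summable (\<lambda>p. if prime p then 1 / real p else 0)"
proof
  assume sm: "summable (\<lambda>p. if prime p then 1 / real p else 0)"
  \<comment> \<open>This is the Cauchy criterion with tolerance 1/2: every finite block of the sum
    from \<open>M\<close> on is less than 1/2.\<close>
  then obtain M where M: "\<And>n. norm (sum (\<lambda>p. if prime p then 1 / real p else 0) {M..<n}) < 1/2"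
    unfolding summable_Cauchy by (meson half_gt_zero_iff order_refl zero_less_one)
  \<comment> \<open>The counting below yields \<open>y \<le> 2 * 2 ^ M\<close>; the value
    \<open>4 * 2 ^ M\<close> violates this.\<close>
  define y :: nat where "y = 2 ^ (M + 2)"
  define x where "x = y\<^sup>2"
  define T where "T = {p\<in>{M..x}. prime p}"
  let ?S = "{n\<in>{1..x}. prime_factors n \<subseteq> {..<M}}"
  have "{1..x} \<subseteq> ?S \<union> (\<Union>p\<in>T. {n\<in>{1..x}. p dvd n})"
  proof
    fix n assume n: "n \<in> {1..x}"
    show "n \<in> ?S \<union> (\<Union>p\<in>T. {n\<in>{1..x}. p dvd n})"
    proof (cases "prime_factors n \<subseteq> {..<M}")
      case False
      then obtain p where p: "p \<in> prime_factors n" "p \<ge> M" by (auto simp: subset_iff not_less)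
      then have "prime p" "p dvd n" by auto
      moreover from this have "p \<le> x" using n dvd_imp_le[of p n] by auto
      ultimately show ?thesis using p n by (auto simp: T_def)
    qed (use n in auto)
  qed
  then have "card {1..x} \<le> card (?S \<union> (\<Union>p\<in>T. {n\<in>{1..x}. p dvd n}))"
    by (intro card_mono) (auto simp: T_def)
  also have "\<dots> \<le> card ?S + card (\<Union>p\<in>T. {n\<in>{1..x}. p dvd n})"
    by (rule card_Un_le)
  also have "\<dots> \<le> 2 ^ M * y + (\<Sum>p\<in>T. card {n\<in>{1..x}. p dvd n})"
    using card_smooth_le[of "{..<M}" y]
    by (intro add_mono card_UN_le) (auto simp: T_def x_def)
  also have "\<dots> \<le> 2 ^ M * y + (\<Sum>p\<in>T. x div p)"
    by (intro add_mono sum_mono card_multiples_le order_refl)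
  finally have "real x \<le> real (2 ^ M * y + (\<Sum>p\<in>T. x div p))"
    by (simp only: of_nat_le_iff card_atLeastAtMost diff_Suc_1)
  also have "\<dots> \<le> 2 ^ M * y + (\<Sum>p\<in>T. real x / real p)"
    by (simp add: sum_mono of_nat_div_le_of_nat)
  also have "(\<Sum>p\<in>T. real x / real p) = real x * (\<Sum>p\<in>T. 1 / real p)"
    by (simp add: sum_distrib_left)
  also have "(\<Sum>p\<in>T. 1 / real p) = sum (\<lambda>p. if prime p then 1 / real p else 0) {M..<Suc x}"
    unfolding T_def by (subst sum.inter_filter) (auto simp: atLeastLessThanSuc_atLeastAtMost)
  also have "\<dots> \<le> 1/2"
    using M[of "Suc x"] by simp
  finally have "real x \<le> 2 ^ M * y + real x * (1/2)"
    by (simp add: mult_left_mono)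
  then have "real y * real y \<le> 2 * 2 ^ M * real y"
    by (simp add: x_def power2_eq_square)
  then have "real y \<le> 2 * 2 ^ M"
    by (simp add: y_def)
  then show False by (simp add: y_def)
qed

text \<open>The primes above the cutoff \<open>N\<close> are grouped by the value \<open>m\<close>
  of \<open>e\<close>. A group has at most \<open>D\<close> members, each with
  \<open>1 / p \<le> C / B ^ m\<close>, so a geometric series would bound all partial sums of the
  prime reciprocals.\<close>

lemma unbounded_prime_fibres:
  fixes e :: "nat \<Rightarrow> nat"
  assumes B: "B > 1" and bound: "\<And>p. prime p \<Longrightarrow> p > N \<Longrightarrow> B ^ e p \<le> C * p"
    and fibre: "\<And>m P. finite P \<Longrightarrow> (\<And>p. p \<in> P \<Longrightarrow> prime p \<and> p > N \<and> e p = m) \<Longrightarrow> card P \<le> D"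
  shows False
proof -
  define r where "r p = (if prime p then 1 / real p else 0)" for p :: nat
  have geo: "summable (\<lambda>m. (1 / real B) ^ m)"
    using B by (intro summable_geometric) auto
  \<comment> \<open>The \<open>N + 1\<close> indices up to \<open>N\<close> contribute at most 1
    each; the remaining term is the bound for the primes above \<open>N\<close>.\<close>
  define K where "K = real N + 1 + real D * real C * (\<Sum>m. (1 / real B) ^ m)"
  have r0: "r p \<ge> 0" "r p \<le> 1" for p
    by (auto simp: r_def prime_gt_0_nat divide_simps Suc_le_eq)
  have "(\<Sum>p<n. r p) \<le> K" for n
  proof -
    define P where "P = {p. prime p \<and> N < p \<and> p < n}"
    have fP: "finite P" unfolding P_def by auto
    have "(\<Sum>p<n. r p) \<le> (\<Sum>p\<in>{..N} \<union> P. r p)"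
    proof -
      have "(\<Sum>p<n. r p) = (\<Sum>p\<in>{..<n} \<inter> ({..N} \<union> P). r p)"
        by (intro sum.mono_neutral_right) (auto simp: P_def r_def)
      also have "\<dots> \<le> (\<Sum>p\<in>{..N} \<union> P. r p)"
        using fP r0 by (intro sum_mono2) auto
      finally show ?thesis .
    qed
    also have "\<dots> \<le> (\<Sum>p\<in>{..N}. r p) + (\<Sum>p\<in>P. r p)"
      using fP by (subst sum.union_disjoint) (auto simp: P_def)
    also have "(\<Sum>p\<in>{..N}. r p) \<le> (\<Sum>p\<in>{..N}. 1)"
      by (intro sum_mono r0)
    also have "\<dots> = real N + 1" by simp
    also have "(\<Sum>p\<in>P. r p) \<le> (\<Sum>p\<in>P. real C * (1 / real B) ^ e p)"
    proof (rule sum_mono)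
      fix p assume p: "p \<in> P"
      have "real (B ^ e p) \<le> real (C * p)"
        using bound[of p] p by (subst of_nat_le_iff) (auto simp: P_def)
      then show "r p \<le> real C * (1 / real B) ^ e p"
        using p B prime_gt_0_nat[of p] by (auto simp: r_def P_def power_divide divide_simps)
    qed
    \<comment> \<open>The sum is split along the fibres of \<open>e\<close>. The exponents in the
      image are distinct, so the outer sum ends up as a subsum of the geometric series.\<close>
    also have "\<dots> = (\<Sum>m\<in>e ` P. \<Sum>p\<in>{p\<in>P. e p = m}. real C * (1 / real B) ^ e p)"
      by (rule sum.image_gen[OF fP])
    also have "\<dots> = (\<Sum>m\<in>e ` P. real (card {p\<in>P. e p = m}) * (real C * (1 / real B) ^ m))"
      by (intro sum.cong refl) simp
    also have "\<dots> \<le> (\<Sum>m\<in>e ` P. real D * (real C * (1 / real B) ^ m))"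
      using fP by (intro sum_mono mult_right_mono) (auto intro!: fibre simp: P_def)
    also have "\<dots> = real D * real C * (\<Sum>m\<in>e ` P. (1 / real B) ^ m)"
      by (simp add: sum_distrib_left mult_ac)
    also have "\<dots> \<le> real D * real C * (\<Sum>m. (1 / real B) ^ m)"
      using fP geo by (intro mult_left_mono sum_le_suminf) auto
    finally show ?thesis by (simp add: K_def)
  qed
  then have "summable r"
    using r0 by (intro summableI_nonneg_bounded[of r K])
  then show False
    using not_summable_prime_reciprocals unfolding r_def by contradiction
qed

section \<open>Prime divisors of polynomial values\<close>

lemma prod_primes_dvd:
  fixes n :: int
  assumes "finite P" "\<And>p. p \<in> P \<Longrightarrow> prime p" "\<And>p. p \<in> P \<Longrightarrow> int p dvd n"
  shows "int (\<Prod>P) dvd n"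
  using assms
proof (induction P)
  case (insert p P)
  have "coprime p (\<Prod>P)"
    using insert by (intro prod_coprime_right primes_coprime) auto
  then have "coprime (int p) (int (\<Prod>P))" by (simp only: coprime_int_iff)
  then have "int p * int (\<Prod>P) dvd n"
    using insert by (intro divides_mult) auto
  then show ?case using insert by simp
qed simp

lemma abs_poly_le:
  fixes G :: "int poly"
  assumes "x \<ge> 1"
  shows "\<bar>poly G x\<bar> \<le> (\<Sum>i\<le>degree G. \<bar>coeff G i\<bar>) * x ^ degree G"
proof -
  have "\<bar>poly G x\<bar> \<le> (\<Sum>i\<le>degree G. \<bar>coeff G i * x ^ i\<bar>)"
    unfolding poly_altdef by (rule sum_abs)
  also have "\<dots> \<le> (\<Sum>i\<le>degree G. \<bar>coeff G i\<bar> * x ^ degree G)"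
    using assms by (intro sum_mono) (auto simp: abs_mult intro!: mult_left_mono power_increasing)
  finally show ?thesis by (simp add: sum_distrib_right)
qed

text \<open>The product of the primes in \<open>P\<close> divides the nonzero value
  \<open>poly G (int B ^ m)\<close>, hence is at most \<open>B ^ (m * const)\<close>. Each factor is
  at least \<open>B ^ (m - k)\<close>, and \<open>m - k\<close> is at least \<open>m / 2\<close>.
  Comparing exponents, \<open>m\<close> cancels and the bound \<open>D\<close> is the same for all
  \<open>m \<ge> N\<close>.\<close>

lemma card_prime_divisors_poly_power_le:
  fixes G :: "int poly"
  assumes "G \<noteq> 0" and B: "B > 1"
  obtains N D where
    "\<And>m P. m \<ge> N \<Longrightarrow> finite P \<Longrightarrow>
      (\<And>p. p \<in> P \<Longrightarrow> prime p \<and> B ^ m \<le> B ^ k * p \<and> int p dvd poly G (int B ^ m)) \<Longrightarrow> card P \<le> D"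
proof -
  define S where "S = (\<Sum>i\<le>degree G. \<bar>coeff G i\<bar>)"
  define c where "c = nat S"
  have S0: "S \<ge> 0" unfolding S_def by (intro sum_nonneg) auto
  obtain Y where Y: "\<And>y. poly G y = 0 \<Longrightarrow> y \<le> Y"
    using poly_roots_finite[OF \<open>G \<noteq> 0\<close>] bdd_above_finite[of "{x. poly G x = 0}"]
    unfolding bdd_above_def by auto
  \<comment> \<open>\<open>nat Y\<close> puts \<open>B ^ m > m\<close> beyond all roots of
    \<open>G\<close>, \<open>2 * k\<close> ensures \<open>m \<le> 2 * (m - k)\<close>, and 1 allows
    division by \<open>m\<close> at the end.\<close>
  define N where "N = Max {nat Y, 2 * k, 1}"
  have "card P \<le> 2 * (c + degree G)"
    if m: "m \<ge> N" and P: "finite P"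
       "\<And>p. p \<in> P \<Longrightarrow> prime p \<and> B ^ m \<le> B ^ k * p \<and> int p dvd poly G (int B ^ m)" for m P
  proof -
    have m': "m \<ge> nat Y" "m \<ge> 2 * k" "m \<ge> 1" using m by (auto simp: N_def)
    have less_pow: "j < B ^ j" for j
      using B by (intro power_gt_expt) simp
    have "int m < int B ^ m"
      using less_pow[of m] by (metis of_nat_less_iff of_nat_power)
    then have nz: "poly G (int B ^ m) \<noteq> 0"
      using Y[of "int B ^ m"] m' by linarith
    have "int (\<Prod>P) dvd poly G (int B ^ m)"
      using P by (intro prod_primes_dvd) auto
    then have "int (\<Prod>P) \<le> \<bar>poly G (int B ^ m)\<bar>"
      using dvd_imp_le_int[OF nz] by (metis abs_of_nat)
    also have "\<dots> \<le> S * (int B ^ m) ^ degree G"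
      unfolding S_def using B by (intro abs_poly_le) simp
    also have "\<dots> = int (c * (B ^ m) ^ degree G)"
      using S0 by (simp add: c_def)
    finally have "\<Prod>P \<le> c * (B ^ m) ^ degree G" by (simp only: of_nat_le_iff)
    \<comment> \<open>The constant \<open>c\<close> is absorbed into a power of \<open>B\<close>, so
      that both bounds on the product become powers of \<open>B\<close>.\<close>
    also have "\<dots> \<le> B ^ (m * c) * (B ^ m) ^ degree G"
    proof (rule mult_right_mono)
      have "c \<le> B ^ c" using less_pow[of c] by simp
      also have "\<dots> \<le> B ^ (m * c)" using B m' by (intro power_increasing) auto
      finally show "c \<le> B ^ (m * c)" .
    qed simp
    also have "\<dots> = B ^ (m * (c + degree G))"
      by (simp add: algebra_simps flip: power_add power_mult)
    finally have upper: "\<Prod>P \<le> B ^ (m * (c + degree G))" .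
    have "B ^ (m - k) \<le> p" if "p \<in> P" for p
    proof -
      have "B ^ k * B ^ (m - k) \<le> B ^ k * p"
        using P(2)[OF that] m' by (simp flip: power_add)
      then show ?thesis using B by simp
    qed
    then have "(\<Prod>p\<in>P. B ^ (m - k)) \<le> \<Prod>P"
      by (intro prod_mono) auto
    with upper have le: "B ^ ((m - k) * card P) \<le> B ^ (m * (c + degree G))"
      by (simp add: power_mult)
    have "m * card P \<le> 2 * (m - k) * card P"
      using m' by (intro mult_right_mono) auto
    also have "\<dots> = 2 * ((m - k) * card P)" by (rule mult.assoc)
    also have "\<dots> \<le> 2 * (m * (c + degree G))"
      using B le by (intro mult_left_mono) (auto dest: power_le_imp_le_exp[rotated])
    finally have "m * card P \<le> m * (2 * (c + degree G))" by (simp only: mult_ac)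
    then show ?thesis using m' by simp
  qed
  then show ?thesis by (rule that)
qed

text \<open>As \<open>b\<close> is inverse to \<open>a\<close> modulo \<open>n\<close>, this is the
  identity \<open>y^d H(1/y) = G(y)\<close> at \<open>y = b\<close>, where \<open>G\<close> is the
  reversed polynomial.\<close>

lemma cong_poly_reflect_poly:
  fixes H :: "int poly"
  assumes "[a * b = 1] (mod n)"
  shows "[b ^ degree H * poly H a = poly (reflect_poly H) b] (mod n)"
proof -
  let ?d = "degree H"
  \<comment> \<open>If the constant coefficient of \<open>H\<close> vanishes, the reversed
    polynomial has smaller degree; the sum is padded with zero terms up to the degree of
    \<open>H\<close>.\<close>
  have "poly (reflect_poly H) b = (\<Sum>i\<le>?d. coeff (reflect_poly H) i * b ^ i)"
    unfolding poly_altdef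
    using degree_reflect_poly_le[of H] by (intro sum.mono_neutral_left) (auto simp: coeff_eq_0)
  also have "\<dots> = (\<Sum>i\<le>?d. coeff H (?d - i) * b ^ i)"
    by (intro sum.cong) (auto simp: coeff_reflect_poly)
  also have "\<dots> = (\<Sum>i\<le>?d. coeff H i * b ^ (?d - i))"
    by (rule sum.reindex_bij_witness[of _ "\<lambda>i. ?d - i" "\<lambda>i. ?d - i"]) auto
  finally have reflect: "poly (reflect_poly H) b = \<dots>" .
  \<comment> \<open>Splitting \<open>b ^ d\<close> as \<open>b ^ (d - i) * b ^ i\<close> pairs each
    power of \<open>a\<close> with the same power of \<open>b\<close>.\<close>
  have "b ^ ?d * poly H a = (\<Sum>i\<le>?d. coeff H i * b ^ (?d - i) * (a * b) ^ i)"
    unfolding poly_altdef sum_distrib_left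
  proof (intro sum.cong refl)
    fix i assume "i \<in> {..?d}"
    then have "b ^ ?d = b ^ (?d - i) * b ^ i" by (simp flip: power_add)
    then show "b ^ ?d * (coeff H i * a ^ i) = coeff H i * b ^ (?d - i) * (a * b) ^ i"
      by (simp add: power_mult_distrib algebra_simps)
  qed
  also have "[\<dots> = (\<Sum>i\<le>?d. coeff H i * b ^ (?d - i) * 1 ^ i)] (mod n)"
    by (intro cong_sum cong_mult cong_refl cong_pow assms)
  finally show ?thesis using reflect by simp
qed

section \<open>Evaluating rational polynomials in the ring of integers modulo almost all primes\<close>

text \<open>Integer values are allowed because the coefficients and values of integer polynomials
  may be negative.\<close>

definition int_image_A :: "(nat \<Rightarrow> int) \<Rightarrow> (nat \<Rightarrow> int) set" where
  "int_image_A a =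
     direct_sum_ideal primes prime_field +>\<^bsub>product_ring primes prime_field\<^esub>
       (\<lambda>p\<in>primes. a p mod int p)"

lemma image_A_conv_int_image_A: "image_A f = int_image_A (\<lambda>p. int (f p))"
  by (simp add: image_A_def int_image_A_def)

context
begin

interpretation P: cring "product_ring primes prime_field"
  by (intro cring_product_ring cring_prime_field)

interpretation I: ideal "direct_sum_ideal primes prime_field" "product_ring primes prime_field"
  by (intro ideal_direct_sum_ideal cring_prime_field)

interpretation A: cring ring_A
  by (rule cring_ring_A)

interpretation h: ring_hom_ring "product_ring primes prime_field" ring_A
    "(+>\<^bsub>product_ring primes prime_field\<^esub>) (direct_sum_ideal primes prime_field)"
  using I.rcos_ring_hom_ring by (simp add: ring_A_def)

private lemma residues_in_carrier:
  "(\<lambda>p\<in>primes. a p mod int p) \<in> carrier (product_ring primes prime_field)"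
  by (auto simp: product_ring_def residue_ring_def prime_gt_0_nat)

lemma int_image_A_closed [simp]: "int_image_A a \<in> carrier ring_A"
  unfolding int_image_A_def by (rule h.hom_closed[OF residues_in_carrier])

text \<open>Reduction modulo \<open>p\<close> and the quotient map both respect addition. With the
  analogous rules that follow, arithmetic in \<open>ring_A\<close> becomes arithmetic of integer
  sequences.\<close>

lemma int_image_A_add: "int_image_A a \<oplus>\<^bsub>ring_A\<^esub> int_image_A b = int_image_A (\<lambda>p. a p + b p)"
proof -
  have "(\<lambda>p\<in>primes. (a p + b p) mod int p) =
      (\<lambda>p\<in>primes. a p mod int p) \<oplus>\<^bsub>product_ring primes prime_field\<^esub> (\<lambda>p\<in>primes. b p mod int p)"
    by (auto simp: product_ring_def residue_ring_def mod_simps intro!: restrict_ext)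
  then show ?thesis
    unfolding int_image_A_def by (simp only: h.hom_add[OF residues_in_carrier residues_in_carrier])
qed

lemma int_image_A_mult: "int_image_A a \<otimes>\<^bsub>ring_A\<^esub> int_image_A b = int_image_A (\<lambda>p. a p * b p)"
proof -
  have "(\<lambda>p\<in>primes. (a p * b p) mod int p) =
      (\<lambda>p\<in>primes. a p mod int p) \<otimes>\<^bsub>product_ring primes prime_field\<^esub> (\<lambda>p\<in>primes. b p mod int p)"
    by (auto simp: product_ring_def residue_ring_def mod_simps intro!: restrict_ext)
  then show ?thesis
    unfolding int_image_A_def by (simp only: h.hom_mult[OF residues_in_carrier residues_in_carrier])
qed

lemma int_image_A_one: "int_image_A (\<lambda>_. 1) = \<one>\<^bsub>ring_A\<^esub>"
proof -
  have "(\<lambda>p\<in>primes. 1 mod int p) = \<one>\<^bsub>product_ring primes prime_field\<^esub>"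
    using prime_gt_1_nat by (auto simp: product_ring_def residue_ring_def intro!: restrict_ext)
  then show ?thesis
    unfolding int_image_A_def by (simp only: h.hom_one)
qed

lemma int_image_A_zero: "int_image_A (\<lambda>_. 0) = \<zero>\<^bsub>ring_A\<^esub>"
proof -
  have "(\<lambda>p\<in>primes. 0 mod int p) = \<zero>\<^bsub>product_ring primes prime_field\<^esub>"
    by (auto simp: product_ring_def residue_ring_def intro!: restrict_ext)
  then show ?thesis
    unfolding int_image_A_def by (simp only: h.hom_zero)
qed

lemma int_image_A_pow: "int_image_A a [^]\<^bsub>ring_A\<^esub> (n::nat) = int_image_A (\<lambda>p. a p ^ n)"
  by (induction n) (simp_all add: int_image_A_one int_image_A_mult mult.commute)

lemma int_image_A_sum:
  assumes "finite J"
  shows "(\<Oplus>\<^bsub>ring_A\<^esub>j\<in>J. int_image_A (a j)) = int_image_A (\<lambda>p. \<Sum>j\<in>J. a j p)"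
  using assms
  by (induction J) (simp_all add: int_image_A_zero int_image_A_add Pi_def)

text \<open>This identifies the numerators and denominators in \<open>rat_image\<close> with
  constant sequences. Negative integers reduce to positive ones by uniqueness of additive
  inverses.\<close>

lemma add_pow_one_ring_A: "[n] \<cdot>\<^bsub>ring_A\<^esub> \<one>\<^bsub>ring_A\<^esub> = int_image_A (\<lambda>_. n)" for n :: int
proof -
  have nat: "[m] \<cdot>\<^bsub>ring_A\<^esub> \<one>\<^bsub>ring_A\<^esub> = int_image_A (\<lambda>_. int m)" for m :: nat
    by (induction m)
      (simp_all add: int_image_A_zero int_image_A_add A.add.nat_pow_Suc add.commute
        flip: int_image_A_one)
  show ?thesis
  proof (cases "n \<ge> 0")
    case True
    then show ?thesis using nat[of "nat n"] by (simp add: add_pow_int_ge)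
  next
    case False
    have "int_image_A (\<lambda>_. n) \<oplus>\<^bsub>ring_A\<^esub> int_image_A (\<lambda>_. - n) = \<zero>\<^bsub>ring_A\<^esub>"
      by (simp add: int_image_A_add int_image_A_zero)
    then have "\<ominus>\<^bsub>ring_A\<^esub> int_image_A (\<lambda>_. - n) = int_image_A (\<lambda>_. n)"
      by (intro A.minus_equality) simp_all
    then show ?thesis using False nat[of "nat (- n)"] by (simp add: add_pow_int_lt)
  qed
qed

text \<open>The zero of the quotient is the direct sum itself, so a sequence with zero class has
  only finitely many nonzero residues.\<close>

lemma int_image_A_eq_zeroD:
  assumes "int_image_A a = \<zero>\<^bsub>ring_A\<^esub>"
  shows "finite {p. prime p \<and> \<not> int p dvd a p}"
proof -
  have "(\<lambda>p\<in>primes. a p mod int p) \<in> direct_sum_ideal primes prime_field"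
  proof (rule I.rcos_const_imp_mem[OF residues_in_carrier[of a]])
    have "\<zero>\<^bsub>ring_A\<^esub> = direct_sum_ideal primes prime_field"
      unfolding ring_A_def FactRing_def by (simp only: ring_record_simps)
    with assms show "direct_sum_ideal primes prime_field +>\<^bsub>product_ring primes prime_field\<^esub>
        (\<lambda>p\<in>primes. a p mod int p) = direct_sum_ideal primes prime_field"
      unfolding int_image_A_def by (rule trans)
  qed
  then have "finite {q \<in> primes. (\<lambda>p\<in>primes. a p mod int p) q \<noteq> 0}"
    by (simp add: direct_sum_ideal_def residue_ring_def)
  then show ?thesis
    by (rule rev_finite_subset) (auto simp: dvd_eq_mod_eq_0)
qed

text \<open>This clears a denominator: it is a unit of \<open>ring_A\<close>, so as a factor of
  \<open>L\<close> it cancels against its inverse.\<close>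

lemma mult_rat_image_ring_A:
  assumes "snd (quotient_of q) dvd L"
  shows "int_image_A (\<lambda>_. L) \<otimes>\<^bsub>ring_A\<^esub> rat_image ring_A q
       = int_image_A (\<lambda>_. L div snd (quotient_of q) * fst (quotient_of q))"
proof -
  let ?s = "snd (quotient_of q)" and ?t = "fst (quotient_of q)"
  have U: "int_image_A (\<lambda>_. ?s) \<in> Units ring_A"
    using rat_denominator_in_Units_ring_A[of ?s] quotient_of_denom_pos'[of q]
    by (simp add: add_pow_one_ring_A)
  have "int_image_A (\<lambda>_. L) = int_image_A (\<lambda>_. L div ?s) \<otimes>\<^bsub>ring_A\<^esub> int_image_A (\<lambda>_. ?s)"
    using assms by (simp add: int_image_A_mult)
  then have "int_image_A (\<lambda>_. L) \<otimes>\<^bsub>ring_A\<^esub> rat_image ring_A q =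
      int_image_A (\<lambda>_. L div ?s) \<otimes>\<^bsub>ring_A\<^esub> int_image_A (\<lambda>_. ?t) \<otimes>\<^bsub>ring_A\<^esub>
        (int_image_A (\<lambda>_. ?s) \<otimes>\<^bsub>ring_A\<^esub> inv\<^bsub>ring_A\<^esub> int_image_A (\<lambda>_. ?s))"
    using U by (simp add: rat_image_def add_pow_one_ring_A A.m_ac del: A.Units_r_inv)
  also have "\<dots> = int_image_A (\<lambda>_. L div ?s * ?t)"
    using U by (simp add: int_image_A_mult)
  finally show ?thesis .
qed

text \<open>Multiplying \<open>F\<close> by a common denominator gives an integer polynomial
  \<open>H\<close>. That its value has zero class means that \<open>p\<close> divides
  \<open>H(a(p))\<close> for almost all primes \<open>p\<close>.\<close>

lemma rat_poly_eval_ring_A_eq_zeroE: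
  assumes "F \<noteq> 0" and zero: "rat_poly_eval ring_A F (int_image_A a) = \<zero>\<^bsub>ring_A\<^esub>"
  obtains H :: "int poly" where "H \<noteq> 0" "finite {p. prime p \<and> \<not> int p dvd poly H (a p)}"
proof -
  let ?d = "degree F"
  let ?s = "\<lambda>i. snd (quotient_of (coeff F i))" and ?t = "\<lambda>i. fst (quotient_of (coeff F i))"
  define L where "L = (\<Prod>i\<le>?d. ?s i)"
  define c where "c i = L div ?s i * ?t i" for i
  have dvd: "?s i dvd L" if "i \<le> ?d" for i
    unfolding L_def using that by (intro dvd_prodI) auto
  define H where "H = (\<Sum>i\<le>?d. monom (c i) i)"
  have s0: "?s i \<noteq> 0" for i
    using quotient_of_denom_pos'[of "coeff F i"] by simp
  have "L \<noteq> 0"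
    by (simp add: L_def s0)
  have rc: "rat_image ring_A q \<in> carrier ring_A" for q
    using rat_denominator_in_Units_ring_A[OF quotient_of_denom_pos'[of q]]
    by (simp add: rat_image_def add_pow_one_ring_A)
  have "\<zero>\<^bsub>ring_A\<^esub> = int_image_A (\<lambda>_. L) \<otimes>\<^bsub>ring_A\<^esub> rat_poly_eval ring_A F (int_image_A a)"
    by (simp add: zero)
  also have "\<dots> = (\<Oplus>\<^bsub>ring_A\<^esub>i\<in>{..?d}. int_image_A (\<lambda>_. L) \<otimes>\<^bsub>ring_A\<^esub>
      (rat_image ring_A (coeff F i) \<otimes>\<^bsub>ring_A\<^esub> int_image_A a [^]\<^bsub>ring_A\<^esub> i))"
    unfolding rat_poly_eval_def
    by (rule A.finsum_rdistr) (auto simp: rc)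
  also have "\<dots> = (\<Oplus>\<^bsub>ring_A\<^esub>i\<in>{..?d}. int_image_A (\<lambda>p. c i * a p ^ i))"
  proof (intro A.finsum_cong')
    fix i assume i: "i \<in> {..?d}"
    then show "int_image_A (\<lambda>_. L) \<otimes>\<^bsub>ring_A\<^esub>
      (rat_image ring_A (coeff F i) \<otimes>\<^bsub>ring_A\<^esub> int_image_A a [^]\<^bsub>ring_A\<^esub> i) =
        int_image_A (\<lambda>p. c i * a p ^ i)"
      using mult_rat_image_ring_A[OF dvd[of i]]
      by (simp add: rc int_image_A_pow int_image_A_mult c_def flip: A.m_assoc)
  qed auto
  also have "\<dots> = int_image_A (\<lambda>p. poly H (a p))"
    by (simp add: int_image_A_sum H_def poly_sum poly_monom)
  finally have "finite {p. prime p \<and> \<not> int p dvd poly H (a p)}"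
    by (intro int_image_A_eq_zeroD) simp
  \<comment> \<open>\<open>H\<close> is nonzero because its coefficient at the degree of
    \<open>F\<close> is a nonzero multiple of the numerator of the leading coefficient of
    \<open>F\<close>.\<close>
  moreover have "coeff H ?d = c ?d"
    by (simp add: H_def coeff_sum)
  moreover have "?t ?d \<noteq> 0"
    using \<open>F \<noteq> 0\<close> quotient_of_div[of "lead_coeff F" "?t ?d" "?s ?d"] by auto
  then have "c ?d \<noteq> 0"
    using \<open>L \<noteq> 0\<close> dvd[of ?d] by (auto simp: c_def dvd_div_eq_0_iff)
  ultimately show ?thesis by (intro that[of H]) auto
qed

end

section \<open>Montgomery reduction\<close>

text \<open>The representing element is the value of \<open>REDC\<close> at 1, which is the inverse
  of \<open>R\<close> modulo \<open>N\<close>.\<close>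

lemma represents_endo_REDC_imp_cong:
  assumes "represents_endo N (c mod int N) (REDC N R)" "N > 1" "coprime R N"
  shows "[c * int R = 1] (mod int N)"
proof -
  let ?i = "modular_inverse (int N) (int R)"
  have "c mod int N = ?i mod int N"
    using assms(1,2) by (simp add: represents_endo_REDC_iff REDC_def residue_ring_def)
  then have "[c * int R = ?i * int R] (mod int N)"
    by (intro cong_mult) (auto simp: cong_def)
  also have "[?i * int R = 1] (mod int N)"
    using assms(3) by (intro cong_modular_inverse2) simp
  finally show ?thesis .
qed

theorem theorem4p1:
  fixes k B :: nat and e R f :: "nat \<Rightarrow> nat"
  assumes "k > 0" and "B > 1"
    and "\<And>p. prime p \<Longrightarrow> e p > 0"
    and "\<And>p. prime p \<Longrightarrow> p > B \<Longrightarrow>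
           real B powi (int (e p) - int k) \<le> real p \<and> p < B ^ e p"
    and "\<And>p. prime p \<Longrightarrow> R p = B ^ e p"
    and "finite {p. prime p \<and> p > B \<and>
           \<not> represents_endo p (int (f p) mod int p) (REDC p (R p))}"
  shows "naively_transcendental (image_A f)"
  unfolding naively_transcendental_def image_A_conv_int_image_A
proof (intro conjI notI int_image_A_closed, elim exE conjE)
  fix F :: "rat poly"
  assume "F \<noteq> 0" "rat_poly_eval ring_A F (int_image_A (\<lambda>p. int (f p))) = \<zero>\<^bsub>ring_A\<^esub>"
  then obtain H :: "int poly" where H: "H \<noteq> 0"
      "finite {p. prime p \<and> \<not> int p dvd poly H (int (f p))}"
    by (rule rat_poly_eval_ring_A_eq_zeroE)
  define G where "G = reflect_poly H"
  have "G \<noteq> 0" using H by (simp add: G_def)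
  obtain N D where ND: "\<And>m P. m \<ge> N \<Longrightarrow> finite P \<Longrightarrow>
      (\<And>p. p \<in> P \<Longrightarrow> prime p \<and> B ^ m \<le> B ^ k * p \<and> int p dvd poly G (int B ^ m)) \<Longrightarrow> card P \<le> D"
    using card_prime_divisors_poly_power_le[OF \<open>G \<noteq> 0\<close> \<open>B > 1\<close>, of k] by metis
  let ?E = "{p. prime p \<and> \<not> int p dvd poly H (int (f p))} \<union>
    {p. prime p \<and> p > B \<and> \<not> represents_endo p (int (f p) mod int p) (REDC p (R p))}"
  obtain M where M: "\<And>p. p \<in> ?E \<Longrightarrow> p \<le> M"
    using finite_nat_set_iff_bounded_le[of ?E] H(2) assms(6) by auto
  \<comment> \<open>For \<open>p > K\<close>, the summand \<open>B\<close> makes the bounds on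
    \<open>e p\<close> available and \<open>p\<close> prime to \<open>B\<close>, \<open>M\<close>
    excludes the exceptional primes, and \<open>B ^ N < p < B ^ e p\<close> forces
    \<open>e p > N\<close>.\<close>
  define K where "K = B + M + B ^ N"
  \<comment> \<open>The exponent \<open>e p - k\<close> may be negative, so the bound is cleared of
    denominators before passing to natural numbers.\<close>
  have upper: "B ^ e p \<le> B ^ k * p" if "prime p" "p > K" for p
  proof -
    have "real B ^ e p / real B ^ k \<le> real p"
      using assms(4)[of p] that \<open>B > 1\<close> by (simp add: K_def power_int_diff)
    then have "real B ^ e p \<le> real B ^ k * real p"
      using \<open>B > 1\<close> by (simp add: divide_simps mult.commute)
    then show ?thesis by (metis of_nat_le_iff of_nat_mult of_nat_power)
  qed
  have dvd: "int p dvd poly G (int B ^ e p)" if p: "prime p" "p > K" for p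
  proof -
    have "p \<notin> ?E" using M[of p] p by (auto simp: K_def)
    then have d: "int p dvd poly H (int (f p))"
      and r: "represents_endo p (int (f p) mod int p) (REDC p (R p))"
      using p by (auto simp: K_def)
    have "\<not> p dvd B" using p \<open>B > 1\<close> by (auto simp: K_def dest: dvd_imp_le)
    then have "coprime (R p) p"
      using p assms(5)[of p] prime_imp_coprime[of p B] by (simp add: coprime_commute)
    then have "[int (f p) * int B ^ e p = 1] (mod int p)"
      using represents_endo_REDC_imp_cong[OF r] p assms(5)[of p] prime_gt_1_nat[of p] by simp
    \<comment> \<open>Here \<open>f p\<close> and \<open>B ^ e p\<close> are mutually inverse modulo
      \<open>p\<close>, so divisibility of \<open>H(f(p))\<close> passes to
      \<open>G(B ^ e p)\<close>.\<close>
    then have "[(int B ^ e p) ^ degree H * poly H (int (f p)) = poly G (int B ^ e p)] (mod int p)"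
      unfolding G_def by (rule cong_poly_reflect_poly)
    then show ?thesis using d by (metis cong_dvd_iff dvd_mult)
  qed
  have large: "e p \<ge> N" if "prime p" "p > K" for p
  proof -
    have "B ^ N < B ^ e p" using assms(4)[of p] that by (simp add: K_def)
    then show ?thesis using \<open>B > 1\<close> by simp
  qed
  show False
  proof (rule unbounded_prime_fibres[OF \<open>B > 1\<close> upper])
    fix m and P :: "nat set"
    assume P: "finite P" "\<And>p. p \<in> P \<Longrightarrow> prime p \<and> p > K \<and> e p = m"
    show "card P \<le> D"
    \<comment> \<open>A member of \<open>P\<close> is what shows \<open>m \<ge> N\<close>, the
      condition for the uniform bound; the empty fibre is treated apart.\<close>
    proof (cases "P = {}")
      case False
      then have "m \<ge> N" using P(2) large by blast
      then show ?thesis using P upper dvd by (intro ND) auto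
    qed simp
  qed
qed

end
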